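(* Let $m>n$, let $B=(B_j(t_i))_{1\le i\le m,\,1\le j\le n}$ be the collocation matrix of the NTP basis $B_1,\dots,B_n$ at $t_1<\dots<t_m$, let $\operatorname{rank}(B)=r$ and let $\sigma_1\ge\sigma_2\ge\cdots\ge\sigma_r>0$ be the (nonzero) singular values of $B$. 1) Let $$\omega^*=\gamma^*=\frac{4\sigma_1\sigma_r}{(\sigma_1+\sigma_r)^2},\qquad \upsilon^*=\frac1{\sigma_1\sigma_r}.$$ The convergence rate of the MLSPIA method for curves at the weights $\omega=\omega^*,\gamma=\gamma^*,\upsilon=\upsilon^*$ is $$\rho(\hat H_{\omega^*,\gamma^*,\upsilon^*})=\frac{\sigma_1-\sigma_r}{\sigma_1+\sigma_r}\le\frac{\sigma_1^2-\sigma_r^2}{\sigma_1^2+\sigma_r^2}<1 .$$ 2) Suppose $B$ has full column rank ($r=n$) and $\sigma_1\ne\sigma_r$. Then the fastest convergence rate of the MLSPIA method for curves is faster than the fastest convergence rate of the LSPIA method, i.e. $$\inf_{\omega,\gamma,\upsilon}\rho(\hat H_{\omega,\gamma,\upsilon})<\inf_{\mu>0}\rho(I_n-\mu B^TB),$$ where the first infimum is over all real weights $\omega,\gamma,\upsilon$ for which $\rho(\hat H_{\omega,\gamma,\upsilon})<1$.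
   Context: Setting: points $Q_1,\dots,Q_m\in\mathbb{R}^d$ and parameters $0=t_1<\cdots<t_m=1$; $B_1,\dots,B_n$ is a normalized totally positive (NTP) basis of a vector space of real functions on $[0,1]$ (basis with $B_i\ge0$, $\sum_i B_i=1$ on $[0,1]$, all of whose collocation matrices at increasing sequences are totally positive, i.e. have all minors nonnegative). MLSPIA method (matrix form), real weights $\omega,\gamma,\upsilon$: with $Q=[Q_1,\dots,Q_m]^T$, $P^k=[P^k_1,\dots,P^k_n]^T$, $\Lambda^k=[\Lambda^k_1,\dots,\Lambda^k_m]^T$ and arbitrary $P^0,\Lambda^0$, $$\Lambda^{k+1}=[(1-\omega)I_m-\gamma\upsilon BB^T]\Lambda^k+\omega(Q-BP^k),\quad P^{k+1}=P^k+\upsilon B^T\Lambda^k,\quad k\ge0,$$ with approximating curves $C^k(t)=\sum_i B_i(t)P_i^k$. Its iteration matrix is $H_{\omega,\gamma,\upsilon}=\begin{pmatrix}(1-\omega)I_m-\gamma\upsilon BB^T&-\omega B\\ \upsilon B^T&I_n\end{pmatrix}$, which is orthogonally similar to $\operatorname{diag}(\hat H_{\omega,\gamma,\upsilon},I_{n-r})$, where, with $\Sigma_r=\operatorname{diag}(\sigma_1,\dots,\sigma_r)$, $$\hat H_{\omega,\gamma,\upsilon}=\begin{pmatrix}(1-\omega)I_r-\gamma\upsilon\Sigma_r^2&0&-\omega\Sigma_r\\0&(1-\omega)I_{m-r}&0\\ \upsilon\Sigma_r&0&I_r\end{pmatrix}\in\mathbb{R}^{(m+r)\times(m+r)}.$$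 The convergence rate of the MLSPIA method at given weights is measured by the spectral radius $\rho(\hat H_{\omega,\gamma,\upsilon})$; a smaller spectral radius means a faster rate. LSPIA method with constant $\mu>0$: $P_i^{k+1}=P_i^k+\mu\sum_{j=1}^m B_i(t_j)(Q_j-C^k(t_j))$, i.e. $P^{k+1}=P^k+\mu B^T(Q-BP^k)$, with iteration matrix $I_n-\mu B^TB$; its convergence rate (for $B$ of full column rank) is measured by $\rho(I_n-\mu B^TB)$. $\rho(\cdot)$ denotes spectral radius. *)

theory Defs
  imports
    "Jordan_Normal_Form.Spectral_Radius"
    "Jordan_Normal_Form.DL_Rank"
    "Jordan_Normal_Form.DL_Submatrix"
begin

text \<open>Functions \<open>b 1, \<dots>, b n\<close> and nodes \<open>t 1, \<dots>, t m\<close> are indexed from 1, whereas the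
  entries of matrices are indexed from 0.\<close>

definition collocation_mat :: "(nat \<Rightarrow> real \<Rightarrow> real) \<Rightarrow> nat \<Rightarrow> (nat \<Rightarrow> real) \<Rightarrow> nat \<Rightarrow> real mat" where
  "collocation_mat b n t m = mat m n (\<lambda>(i, j). b (Suc j) (t (Suc i)))"

definition totally_positive_mat :: "real mat \<Rightarrow> bool" where
  "totally_positive_mat A \<longleftrightarrow>
     (\<forall>I J. I \<subseteq> {..<dim_row A} \<and> J \<subseteq> {..<dim_col A} \<and> card I = card J
        \<longrightarrow> 0 \<le> det (submatrix A I J))"

text \<open>The functions \<open>b 1, \<dots>, b n\<close> are regarded as functions on \<open>{0..1}\<close> only. They are a basis of
  some vector space of functions iff they are linearly independent; the space is then their span.\<close>

definition ntp_basis :: "(nat \<Rightarrow> real \<Rightarrow> real) \<Rightarrow> nat \<Rightarrow> bool" where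
  "ntp_basis b n \<longleftrightarrow>
     (\<forall>c. (\<forall>x\<in>{0..1}. (\<Sum>i=1..n. c i * b i x) = 0) \<longrightarrow> (\<forall>i\<in>{1..n}. c i = 0)) \<and>
     (\<forall>i\<in>{1..n}. \<forall>x\<in>{0..1}. 0 \<le> b i x) \<and>
     (\<forall>x\<in>{0..1}. (\<Sum>i=1..n. b i x) = 1) \<and>
     (\<forall>k x. strict_mono_on {1..k} x \<and> x ` {1..k} \<subseteq> {0..1}
        \<longrightarrow> totally_positive_mat (collocation_mat b n x k))"

text \<open>The multiset of the square roots of the eigenvalues of \<open>A\<^sup>T A\<close>, counted with algebraic
  multiplicity. These eigenvalues are real and nonnegative, so the real roots of the characteristic
  polynomial are all of its roots.\<close>

definition singular_values :: "real mat \<Rightarrow> real multiset" where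
  "singular_values A = image_mset sqrt (proots (char_poly (transpose_mat A * A)))"

text \<open>The spectral radius of a real matrix takes its non-real eigenvalues into account.\<close>

definition real_spectral_radius :: "real mat \<Rightarrow> real" where
  "real_spectral_radius A = spectral_radius (map_mat complex_of_real A)"

definition append_cols :: "'a :: zero mat \<Rightarrow> 'a mat \<Rightarrow> 'a mat" where
  "append_cols A B = four_block_mat A B (0\<^sub>m 0 (dim_col A)) (0\<^sub>m 0 (dim_col B))"

text \<open>The iteration matrix of the MLSPIA method
    \<open>\<Lambda> (k + 1) = ((1 - \<omega>) I - \<gamma> \<upsilon> B B\<^sup>T) \<Lambda> k + \<omega> (Q - B P k)\<close>,
    \<open>P (k + 1) = P k + \<upsilon> B\<^sup>T \<Lambda> k\<close>
  for an \<open>m \<times> n\<close> matrix \<open>B\<close> of rank \<open>r\<close> is orthogonally similar to the block diagonal matrix with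
  blocks \<open>mlspia_mat m r \<sigma> \<omega> \<gamma> \<upsilon>\<close> and the identity of size \<open>n - r\<close>, where \<open>\<sigma> 1, \<dots>, \<sigma> r\<close> are the
  nonzero singular values of \<open>B\<close>. The convergence rate of the method is measured by the spectral
  radius of the first block.\<close>

definition mlspia_mat :: "nat \<Rightarrow> nat \<Rightarrow> (nat \<Rightarrow> real) \<Rightarrow> real \<Rightarrow> real \<Rightarrow> real \<Rightarrow> real mat" where
  "mlspia_mat m r \<sigma> \<omega> \<gamma> \<upsilon> =
     (let S = mat_diag r (\<lambda>i. \<sigma> (Suc i)) in
      four_block_mat
        (four_block_mat
           ((1 - \<omega>) \<cdot>\<^sub>m 1\<^sub>m r - (\<gamma> * \<upsilon>) \<cdot>\<^sub>m (S * S)) (0\<^sub>m r (m - r))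
           (0\<^sub>m (m - r) r)                             ((1 - \<omega>) \<cdot>\<^sub>m 1\<^sub>m (m - r)))
        (((- \<omega>) \<cdot>\<^sub>m S) @\<^sub>r 0\<^sub>m (m - r) r)
        (append_cols (\<upsilon> \<cdot>\<^sub>m S) (0\<^sub>m r (m - r)))
        (1\<^sub>m r))"

text \<open>The iteration matrix of the LSPIA method \<open>P (k + 1) = P k + \<mu> B\<^sup>T (Q - B P k)\<close>.\<close>

definition lspia_mat :: "real mat \<Rightarrow> real \<Rightarrow> real mat" where
  "lspia_mat B \<mu> = 1\<^sub>m (dim_col B) - \<mu> \<cdot>\<^sub>m (transpose_mat B * B)"

end

theory Submission
  imports Defs "Jordan_Normal_Form.DL_Rank_Submatrix"
begin

text \<open>
  After a permutation of coordinates \<open>mlspia_mat\<close> splits into one \<open>2 \<times> 2\<close> block for each nonzero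
  singular value \<open>s\<close> and the scalar \<open>1 - \<omega>\<close> on the rest of the space. The block of \<open>s\<close> has the
  characteristic polynomial
  \<open>z\<^sup>2 - (2 - \<omega> - \<gamma> \<upsilon> s\<^sup>2) z + (1 - \<omega> - \<gamma> \<upsilon> s\<^sup>2 + \<omega> \<upsilon> s\<^sup>2)\<close>;
  this is \<open>eigenvalue_mlspia_mat_iff\<close>. The choice \<open>\<gamma> = \<omega>\<close> makes the constant coefficient equal to
  \<open>1 - \<omega>\<close>, independently of \<open>s\<close>, as in the heavy-ball method of optimization. As long as the
  discriminant is not positive, both roots then have modulus \<open>\<surd>(1 - \<omega>)\<close>, whatever \<open>s\<close> is
  (\<open>cmod_root_of_real_quadratic\<close>). With the weights \<open>\<omega>\<^sup>*\<close>, \<open>\<gamma>\<^sup>*\<close>, \<open>\<upsilon>\<^sup>*\<close> the discriminant vanishes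
  at the two extreme singular values \<open>\<sigma>\<^sub>1\<close> and \<open>\<sigma>\<^sub>r\<close> and is not positive in between
  (\<open>balanced_weights_bound\<close>). Hence the spectral radius is
  \<open>\<rho> = \<surd>(1 - \<omega>\<^sup>*) = (\<sigma>\<^sub>1 - \<sigma>\<^sub>r) / (\<sigma>\<^sub>1 + \<sigma>\<^sub>r)\<close>; the remaining eigenvalue \<open>1 - \<omega>\<^sup>* = \<rho>\<^sup>2\<close> is not larger.

  For LSPIA the numbers \<open>1 - \<mu> \<sigma>\<^sub>1\<^sup>2\<close> and \<open>1 - \<mu> \<sigma>\<^sub>r\<^sup>2\<close> are eigenvalues of the iteration matrix,
  and no \<open>\<mu>\<close> brings both below \<open>\<tau> = (\<sigma>\<^sub>1\<^sup>2 - \<sigma>\<^sub>r\<^sup>2) / (\<sigma>\<^sub>1\<^sup>2 + \<sigma>\<^sub>r\<^sup>2)\<close> in absolute value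
  (\<open>lspia_mat_spectral_radius_ge\<close>). If \<open>\<sigma>\<^sub>1 \<noteq> \<sigma>\<^sub>r\<close>, then \<open>\<rho> < \<tau>\<close> because
  \<open>\<sigma>\<^sub>1\<^sup>2 + \<sigma>\<^sub>r\<^sup>2 < (\<sigma>\<^sub>1 + \<sigma>\<^sub>r)\<^sup>2\<close>, so this single choice of the MLSPIA weights already beats all \<open>\<mu>\<close>
  by a fixed margin. That \<open>\<sigma>\<^sub>1\<close> and \<open>\<sigma>\<^sub>r\<close> exist at all comes from the normalization of the basis:
  the rows of \<open>B\<close> sum to 1, so \<open>B\<close> has positive rank.
\<close>

section \<open>Spectral radii of real matrices\<close>

lemma real_spectral_radius_mem:
  assumes "A \<in> carrier_mat k k" and "0 < k"
  obtains z where "eigenvalue (map_mat complex_of_real A) z" and "real_spectral_radius A = cmod z"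
  using spectral_radius_mem_max(1)[of "map_mat complex_of_real A" k] assms
  unfolding real_spectral_radius_def spectrum_def by auto

lemma cmod_le_real_spectral_radius:
  assumes "A \<in> carrier_mat k k" and "0 < k" and "eigenvalue (map_mat complex_of_real A) z"
  shows "cmod z \<le> real_spectral_radius A"
  using spectral_radius_mem_max(2)[of "map_mat complex_of_real A" k] assms
  unfolding real_spectral_radius_def spectrum_def by auto

lemma abs_le_real_spectral_radius:
  assumes "A \<in> carrier_mat k k" and "0 < k" and "eigenvalue A x"
  shows "\<bar>x\<bar> \<le> real_spectral_radius A"
proof -
  have "eigenvalue (map_mat complex_of_real A) (complex_of_real x)"
    using of_real_hom.eigenvalue_hom assms(1,3) by blast
  from cmod_le_real_spectral_radius[OF assms(1,2) this] show ?thesis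
    by simp
qed

lemma real_spectral_radius_nonneg:
  assumes "A \<in> carrier_mat k k" and "0 < k"
  shows "0 \<le> real_spectral_radius A"
  by (rule real_spectral_radius_mem[OF assms]) simp

lemma eigenvalue_one_minus_smult:
  fixes A :: "'a :: field mat"
  assumes A: "A \<in> carrier_mat k k" and "eigenvalue A x"
  shows "eigenvalue (1\<^sub>m k - c \<cdot>\<^sub>m A) (1 - c * x)"
proof -
  from assms obtain v where v: "v \<in> carrier_vec k" "v \<noteq> 0\<^sub>v k" and Av: "A *\<^sub>v v = x \<cdot>\<^sub>v v"
    unfolding eigenvalue_def eigenvector_def by auto
  have "(1\<^sub>m k - c \<cdot>\<^sub>m A) *\<^sub>v v = v - c \<cdot>\<^sub>v (A *\<^sub>v v)"
  proof -
    have "(c \<cdot>\<^sub>m A) *\<^sub>v v = c \<cdot>\<^sub>v (A *\<^sub>v v)"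
      using A v by (intro eq_vecI) auto
    then show ?thesis
      using A v by (simp add: minus_mult_distrib_mat_vec[of _ k k])
  qed
  also have "\<dots> = (1 - c * x) \<cdot>\<^sub>v v"
    unfolding Av using v by (intro eq_vecI) (auto simp: algebra_simps)
  finally show ?thesis
    using A v unfolding eigenvalue_def eigenvector_def by auto
qed

section \<open>Two-dimensional blocks\<close>

text \<open>One nonzero row of a singular \<open>2 \<times> 2\<close> matrix determines a kernel vector orthogonal to it. This
  description covers the degenerate blocks, such as those with \<open>\<upsilon> = 0\<close>, uniformly.\<close>

lemma two_by_two_kernel_nontrivial_iff:
  fixes a b c d :: "'a :: field"
  shows "(\<exists>x y. (x, y) \<noteq> (0, 0) \<and> a * x + b * y = 0 \<and> c * x + d * y = 0) \<longleftrightarrow> a * d = b * c"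
    (is "?L \<longleftrightarrow> ?R")
proof
  assume ?L
  then obtain x y where xy: "(x, y) \<noteq> (0, 0)" and e: "a * x + b * y = 0" "c * x + d * y = 0"
    by blast
  have "(a * d - b * c) * x = d * (a * x + b * y) - b * (c * x + d * y)"
    and "(a * d - b * c) * y = a * (c * x + d * y) - c * (a * x + b * y)"
    by (simp_all add: algebra_simps)
  with e xy show ?R by auto
next
  assume R: ?R
  show ?L
  proof (cases "c = 0 \<and> d = 0")
    case cd: True
    show ?thesis
    proof (cases "a = 0 \<and> b = 0")
      case True
      with cd show ?thesis by (intro exI[of _ 1] exI[of _ 0]) auto
    next
      case False
      with cd show ?thesis by (intro exI[of _ "- b"] exI[of _ a]) auto
    qed
  next
    case False
    with R show ?thesis by (intro exI[of _ "- d"] exI[of _ c]) (auto simp: algebra_simps)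
  qed
qed

text \<open>The roots of a real quadratic with nonpositive discriminant are complex conjugate (or equal),
  so their product \<open>q\<close> is the square of their common modulus.\<close>

lemma cmod_root_of_real_quadratic:
  fixes p q :: real and z :: complex
  assumes root: "z\<^sup>2 - of_real p * z + of_real q = 0" and disc: "p\<^sup>2 \<le> 4 * q"
  shows "(cmod z)\<^sup>2 = q"
proof -
  define x y where "x = Re z" and "y = Im z"
  have re: "x\<^sup>2 - y\<^sup>2 - p * x + q = 0"
    using arg_cong[OF root, of Re] by (simp add: x_def y_def power2_eq_square)
  have im: "y * (2 * x - p) = 0"
    using arg_cong[OF root, of Im] by (simp add: x_def y_def power2_eq_square algebra_simps)
  have p: "p = 2 * x"
  proof (cases "y = 0")
    case True
    have "(2 * x - p)\<^sup>2 = 4 * (x\<^sup>2 - y\<^sup>2 - p * x + q) + p\<^sup>2 - 4 * q"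
      using True by (simp add: power2_eq_square algebra_simps)
    with re disc have "(2 * x - p)\<^sup>2 \<le> 0" by simp
    then show ?thesis by simp
  qed (use im in simp)
  have "x\<^sup>2 + y\<^sup>2 = q"
    using re unfolding p by (simp add: power2_eq_square)
  then show ?thesis
    by (simp add: cmod_power2 x_def y_def)
qed

section \<open>Eigenvalues of the MLSPIA matrix\<close>

lemma mlspia_mat_carrier:
  assumes "r \<le> m"
  shows "mlspia_mat m r \<sigma> \<omega> \<gamma> \<upsilon> \<in> carrier_mat (m + r) (m + r)"
  using assms
  by (auto simp: mlspia_mat_def append_cols_def append_rows_def mat_diag_def Let_def)

lemma mlspia_mat_index:
  assumes "r \<le> m" and "i < m + r" and "j < m + r"
  shows "mlspia_mat m r \<sigma> \<omega> \<gamma> \<upsilon> $$ (i, j) =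
    (if i < r then
       (if j = i then 1 - \<omega> - \<gamma> * \<upsilon> * (\<sigma> (Suc i))\<^sup>2
        else if j = m + i then - \<omega> * \<sigma> (Suc i) else 0)
     else if i < m then (if j = i then 1 - \<omega> else 0)
     else (if j = i - m then \<upsilon> * \<sigma> (Suc j) else if j = i then 1 else 0))"
proof -
  note defs = mlspia_mat_def append_cols_def append_rows_def Let_def mat_diag_diag
    power2_eq_square
  consider "i < r" | "r \<le> i" "i < m" | "m \<le> i" by linarith
  then show ?thesis
    using assms unfolding defs by cases (simp_all add: mat_diag_def, auto)
qed

text \<open>Reading \<open>v\<close> as a triple \<open>(x, y, z)\<close> of lengths \<open>r\<close>, \<open>m - r\<close> and \<open>r\<close>, the matrix couples \<open>x\<^sub>i\<close>
  only with \<open>z\<^sub>i\<close>, and acts on \<open>y\<close> as a scalar.\<close>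

lemma mlspia_mat_mult_vec_index:
  fixes v :: "complex vec"
  assumes rm: "r < m" and v: "v \<in> carrier_vec (m + r)" and i: "i < m + r"
  shows "(map_mat complex_of_real (mlspia_mat m r \<sigma> \<omega> \<gamma> \<upsilon>) *\<^sub>v v) $ i =
    (if i < r then
       of_real (1 - \<omega> - \<gamma> * \<upsilon> * (\<sigma> (Suc i))\<^sup>2) * v $ i - of_real (\<omega> * \<sigma> (Suc i)) * v $ (m + i)
     else if i < m then of_real (1 - \<omega>) * v $ i
     else of_real (\<upsilon> * \<sigma> (Suc (i - m))) * v $ (i - m) + v $ i)"
    (is "_ = ?rhs")
proof -
  let ?H = "mlspia_mat m r \<sigma> \<omega> \<gamma> \<upsilon>"
  have H: "?H \<in> carrier_mat (m + r) (m + r)"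
    using mlspia_mat_carrier rm by simp
  have "(map_mat complex_of_real ?H *\<^sub>v v) $ i
      = (\<Sum>j\<in>{0..<m + r}. complex_of_real (?H $$ (i, j)) * v $ j)"
    using H v i by (auto simp: scalar_prod_def intro!: sum.cong)
  also have "\<dots> = (\<Sum>j\<in>{0..<m + r}.
      if i < r then
        (if j = i then of_real (1 - \<omega> - \<gamma> * \<upsilon> * (\<sigma> (Suc i))\<^sup>2) * v $ i else 0)
        + (if j = m + i then - of_real (\<omega> * \<sigma> (Suc i)) * v $ (m + i) else 0)
      else if i < m then (if j = i then of_real (1 - \<omega>) * v $ i else 0)
      else (if j = i - m then of_real (\<upsilon> * \<sigma> (Suc (i - m))) * v $ (i - m) else 0)
        + (if j = i then v $ i else 0))"
    using rm i by (intro sum.cong refl) (auto simp: mlspia_mat_index)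
  also have "\<dots> = ?rhs"
    using rm i by (cases "i < r"; cases "i < m") (simp_all add: sum.distrib)
  finally show ?thesis .
qed

text \<open>An eigenvector has a nonzero component, which lies either in the scalar part or in one of the
  \<open>2 \<times> 2\<close> blocks; conversely, an eigenvector of a block extends by zero.\<close>

lemma eigenvalue_mlspia_mat_iff:
  assumes rm: "r < m"
  shows "eigenvalue (map_mat complex_of_real (mlspia_mat m r \<sigma> \<omega> \<gamma> \<upsilon>)) z \<longleftrightarrow>
    z = of_real (1 - \<omega>) \<or>
    (\<exists>i\<in>{1..r}. z\<^sup>2 - of_real (2 - \<omega> - \<gamma> * \<upsilon> * (\<sigma> i)\<^sup>2) * z
                + of_real (1 - \<omega> - \<gamma> * \<upsilon> * (\<sigma> i)\<^sup>2 + \<omega> * \<upsilon> * (\<sigma> i)\<^sup>2) = 0)"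
    (is "eigenvalue ?H z \<longleftrightarrow> z = ?w \<or> (\<exists>i\<in>{1..r}. ?q i = 0)")
proof -
  define a where "a i = complex_of_real (1 - \<omega> - \<gamma> * \<upsilon> * (\<sigma> (Suc i))\<^sup>2) - z" for i
  define s where "s i = - complex_of_real (\<omega> * \<sigma> (Suc i))" for i
  define u where "u i = complex_of_real (\<upsilon> * \<sigma> (Suc i))" for i
  let ?N = "m + r"
  have H: "?H \<in> carrier_mat ?N ?N"
    using mlspia_mat_carrier[of r m] rm by simp
  have block: "?q (Suc i) = 0 \<longleftrightarrow> a i * (1 - z) = s i * u i" for i
    by (auto simp: a_def s_def u_def algebra_simps power2_eq_square)
  have index: "(?H *\<^sub>v v) $ i = z * v $ i \<longleftrightarrow>
     (if i < r then a i * v $ i + s i * v $ (m + i) = 0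
      else if i < m then ?w * v $ i = z * v $ i
      else u (i - m) * v $ (i - m) + (1 - z) * v $ i = 0)"
    if v: "v \<in> carrier_vec ?N" and i: "i < ?N" for v i
    using mlspia_mat_mult_vec_index[OF rm v i, of \<sigma> \<omega> \<gamma> \<upsilon>]
    by (auto simp: a_def s_def u_def algebra_simps)
  have eigenvector_iff: "?H *\<^sub>v v = z \<cdot>\<^sub>v v \<longleftrightarrow> (\<forall>i < ?N. (?H *\<^sub>v v) $ i = z * v $ i)"
    if "v \<in> carrier_vec ?N" for v
    using that H by (auto simp: vec_eq_iff)
  show ?thesis
  proof
    assume "eigenvalue ?H z"
    then obtain v where v: "v \<in> carrier_vec ?N" "v \<noteq> 0\<^sub>v ?N" and "?H *\<^sub>v v = z \<cdot>\<^sub>v v"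
      using H unfolding eigenvalue_def eigenvector_def by auto
    then have ev: "(?H *\<^sub>v v) $ i = z * v $ i" if "i < ?N" for i
      using that eigenvector_iff by blast
    from v obtain j where j: "j < ?N" "v $ j \<noteq> 0"
      by (auto simp: vec_eq_iff)
    have in_block: "\<exists>i\<in>{1..r}. ?q i = 0" if k: "k < r" "(v $ k, v $ (m + k)) \<noteq> (0, 0)" for k
    proof -
      have "a k * v $ k + s k * v $ (m + k) = 0"
        using index[OF v(1), of k] ev[of k] k(1) by simp
      moreover have "u k * v $ k + (1 - z) * v $ (m + k) = 0"
        using index[OF v(1), of "m + k"] ev[of "m + k"] k(1) rm by simp
      ultimately have "?q (Suc k) = 0"
        unfolding block two_by_two_kernel_nontrivial_iff[symmetric] using k(2) by blast
      with k(1) show ?thesis by (intro bexI[of _ "Suc k"]) auto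
    qed
    consider "j < r" | "r \<le> j" "j < m" | "m \<le> j" by linarith
    then show "z = ?w \<or> (\<exists>i\<in>{1..r}. ?q i = 0)"
    proof cases
      case 1
      then show ?thesis using in_block[of j] j by blast
    next
      case 2
      then show ?thesis using index[OF v(1) j(1)] ev[OF j(1)] j(2) by simp
    next
      case 3
      then show ?thesis using in_block[of "j - m"] j by simp
    qed
  next
    assume "z = ?w \<or> (\<exists>i\<in>{1..r}. ?q i = 0)"
    then have "\<exists>v. v \<in> carrier_vec ?N \<and> v \<noteq> 0\<^sub>v ?N \<and> (\<forall>i < ?N. (?H *\<^sub>v v) $ i = z * v $ i)"
    proof
      assume w: "z = ?w"
      \<comment> \<open>Position \<open>r\<close> belongs to the scalar part because \<open>r < m\<close>.\<close>
      let ?v = "unit_vec ?N r :: complex vec"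
      have "(?H *\<^sub>v ?v) $ i = z * ?v $ i" if "i < ?N" for i
        using that rm w unfolding index[OF unit_vec_carrier that] by auto
      then show ?thesis
        using rm by (intro exI[of _ ?v]) (auto simp: unit_vec_nonzero)
    next
      assume "\<exists>i\<in>{1..r}. ?q i = 0"
      then obtain k where k: "k < r" "?q (Suc k) = 0"
        by (metis Suc_le_D Suc_le_lessD atLeastAtMost_iff One_nat_def)
      then obtain x y where xy: "(x, y) \<noteq> (0, 0)"
        and ker: "a k * x + s k * y = 0" "u k * x + (1 - z) * y = 0"
        unfolding block two_by_two_kernel_nontrivial_iff[symmetric] by blast
      let ?v = "vec ?N (\<lambda>j. if j = k then x else if j = m + k then y else 0)"
      have "(?H *\<^sub>v ?v) $ i = z * ?v $ i" if i: "i < ?N" for i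
      proof -
        consider "i < r" | "r \<le> i" "i < m" | "m \<le> i" by linarith
        then show ?thesis
          using i rm k ker unfolding index[OF vec_carrier i] by cases auto
      qed
      moreover have "?v \<noteq> 0\<^sub>v ?N"
      proof
        assume "?v = 0\<^sub>v ?N"
        then have "?v $ k = 0" "?v $ (m + k) = 0" using k rm by auto
        then show False using xy k rm by auto
      qed
      ultimately show ?thesis
        by (intro exI[of _ ?v]) auto
    qed
    then show "eigenvalue ?H z"
      using H eigenvector_iff unfolding eigenvalue_def eigenvector_def by auto
  qed
qed

section \<open>The MLSPIA spectral radius at the balanced weights\<close>

text \<open>Let \<open>\<rho> = (a - c) / (a + c)\<close>. The quantity between the bars is affine in \<open>s\<^sup>2\<close>, and it equals
  \<open>2\<rho>\<close> at \<open>s = c\<close> and \<open>- 2\<rho>\<close> at \<open>s = a\<close>: this balance of the two ends singles out the weights.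
  Since \<open>\<rho>\<^sup>2 = 1 - \<omega>\<close>, the bound says that the block of the singular value \<open>s\<close> has a nonpositive
  discriminant.\<close>

lemma balanced_weights_bound:
  fixes a c s :: real
  assumes "0 < c" and "c \<le> s" and "s \<le> a"
  defines "\<omega> \<equiv> 4 * a * c / (a + c)\<^sup>2"
  shows "\<bar>2 - \<omega> - \<omega> * (1 / (a * c)) * s\<^sup>2\<bar> \<le> 2 * ((a - c) / (a + c))"
proof -
  have pos: "0 < a" "0 < a + c" using assms by auto
  have s2: "c\<^sup>2 \<le> s\<^sup>2" "s\<^sup>2 \<le> a\<^sup>2" using assms by (auto intro: power_mono)
  have "2 - \<omega> - \<omega> * (1 / (a * c)) * s\<^sup>2 = (2 * (a\<^sup>2 + c\<^sup>2) - 4 * s\<^sup>2) / (a + c)\<^sup>2"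
  proof -
    have "2 - \<omega> = 2 * (a + c)\<^sup>2 / (a + c)\<^sup>2 - 4 * a * c / (a + c)\<^sup>2"
      using pos by (simp add: \<omega>_def)
    also have "\<dots> = 2 * (a\<^sup>2 + c\<^sup>2) / (a + c)\<^sup>2"
      unfolding diff_divide_distrib[symmetric] by (simp add: power2_sum algebra_simps)
    finally have "2 - \<omega> = 2 * (a\<^sup>2 + c\<^sup>2) / (a + c)\<^sup>2" .
    moreover have "\<omega> * (1 / (a * c)) * s\<^sup>2 = 4 * s\<^sup>2 / (a + c)\<^sup>2"
      using pos assms(1) by (simp add: \<omega>_def)
    ultimately show ?thesis by (simp add: diff_divide_distrib)
  qed
  moreover have "2 * ((a - c) / (a + c)) = 2 * (a\<^sup>2 - c\<^sup>2) / (a + c)\<^sup>2"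
    using pos by (simp add: power2_eq_square square_diff_square_factored)
  moreover have "\<bar>2 * (a\<^sup>2 + c\<^sup>2) - 4 * s\<^sup>2\<bar> \<le> 2 * (a\<^sup>2 - c\<^sup>2)"
    using s2 by (simp add: abs_le_iff)
  ultimately show ?thesis
    using pos by (simp add: divide_right_mono)
qed

text \<open>All \<open>2 \<times> 2\<close> blocks have their eigenvalues on the circle of radius \<open>\<rho>\<close>, so the block of any
  singular value shows that the radius is attained.\<close>

lemma real_spectral_radius_mlspia_mat_balanced:
  fixes \<sigma> :: "nat \<Rightarrow> real"
  assumes r: "1 \<le> r" "r < m"
    and pos: "0 < \<sigma> r" and range: "\<And>i. i \<in> {1..r} \<Longrightarrow> \<sigma> r \<le> \<sigma> i \<and> \<sigma> i \<le> \<sigma> 1"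
  defines "\<omega> \<equiv> 4 * \<sigma> 1 * \<sigma> r / (\<sigma> 1 + \<sigma> r)\<^sup>2"
  shows "real_spectral_radius (mlspia_mat m r \<sigma> \<omega> \<omega> (1 / (\<sigma> 1 * \<sigma> r)))
    = (\<sigma> 1 - \<sigma> r) / (\<sigma> 1 + \<sigma> r)"
proof -
  define \<rho> where "\<rho> = (\<sigma> 1 - \<sigma> r) / (\<sigma> 1 + \<sigma> r)"
  let ?\<upsilon> = "1 / (\<sigma> 1 * \<sigma> r)"
  let ?H = "mlspia_mat m r \<sigma> \<omega> \<omega> ?\<upsilon>"
  have pos1: "\<sigma> r \<le> \<sigma> 1" "0 < \<sigma> 1" using range[of r] r pos by auto
  have \<rho>: "0 \<le> \<rho>" "\<rho> < 1" using pos pos1 by (auto simp: \<rho>_def)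
  have \<omega>: "1 - \<omega> = \<rho>\<^sup>2"
    using pos pos1 unfolding \<omega>_def \<rho>_def power_divide
    by (simp add: divide_simps) (simp add: power2_eq_square algebra_simps)
  have H: "?H \<in> carrier_mat (m + r) (m + r)" "0 < m + r"
    using mlspia_mat_carrier r by auto
  define p where "p i = 2 - \<omega> - \<omega> * ?\<upsilon> * (\<sigma> i)\<^sup>2" for i
  have disc: "(p i)\<^sup>2 \<le> 4 * \<rho>\<^sup>2" if "i \<in> {1..r}" for i
  proof -
    have "\<bar>p i\<bar> \<le> 2 * \<rho>"
      unfolding p_def \<rho>_def \<omega>_def using balanced_weights_bound range[OF that] pos by blast
    then have "(p i)\<^sup>2 \<le> (2 * \<rho>)\<^sup>2" by (metis abs_ge_zero power2_abs power_mono)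
    then show ?thesis by (simp add: power_mult_distrib)
  qed
  have eigenvalue_iff: "eigenvalue (map_mat complex_of_real ?H) z \<longleftrightarrow>
      z = of_real (\<rho>\<^sup>2) \<or> (\<exists>i\<in>{1..r}. z\<^sup>2 - of_real (p i) * z + of_real (\<rho>\<^sup>2) = 0)" for z
    unfolding eigenvalue_mlspia_mat_iff[OF r(2)] p_def \<omega>[symmetric] by simp
  have block: "cmod z = \<rho>"
    if "i \<in> {1..r}" and "z\<^sup>2 - of_real (p i) * z + of_real (\<rho>\<^sup>2) = 0" for i z
    using cmod_root_of_real_quadratic[OF that(2) disc[OF that(1)]] \<rho> by simp
  obtain z where "eigenvalue (map_mat complex_of_real ?H) z" "real_spectral_radius ?H = cmod z"
    using real_spectral_radius_mem[OF H] .
  moreover have "\<rho>\<^sup>2 \<le> \<rho>" using \<rho> by (simp add: power2_eq_square mult_left_le)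
  ultimately have "real_spectral_radius ?H \<le> \<rho>"
    unfolding eigenvalue_iff using block by (auto simp: norm_power abs_of_nonneg[OF \<rho>(1)])
  moreover have "\<rho> \<le> real_spectral_radius ?H"
  proof -
    \<comment> \<open>Any root of the first block attains the bound; the fundamental theorem of algebra provides
      one.\<close>
    obtain z :: complex where z: "z\<^sup>2 - of_real (p 1) * z + of_real (\<rho>\<^sup>2) = 0"
    proof -
      have "\<not> constant (poly [:complex_of_real (\<rho>\<^sup>2), - of_real (p 1), 1:])"
        by (simp add: constant_degree)
      from fundamental_theorem_of_algebra[OF this] that show ?thesis
        by (auto simp: power2_eq_square algebra_simps)
    qed
    have "1 \<in> {1..r}" using r by simp
    with z have "eigenvalue (map_mat complex_of_real ?H) z" unfolding eigenvalue_iff by blast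
    from cmod_le_real_spectral_radius[OF H this] block[OF \<open>1 \<in> {1..r}\<close> z]
    show ?thesis by simp
  qed
  ultimately show ?thesis by (simp add: \<rho>_def)
qed

section \<open>A lower bound for the LSPIA spectral radius\<close>

text \<open>At \<open>\<mu> = 2 / (a + c)\<close> the numbers \<open>\<mu>a - 1\<close> and \<open>1 - \<mu>c\<close> coincide; a larger \<open>\<mu>\<close> increases the
  first of them, a smaller one the second.\<close>

lemma two_point_step_size_bound:
  fixes a c \<mu> :: real
  assumes "0 \<le> a" and "0 \<le> c" and "0 < a + c"
  shows "(a - c) / (a + c) \<le> max \<bar>1 - \<mu> * a\<bar> \<bar>1 - \<mu> * c\<bar>"
proof (cases "2 / (a + c) \<le> \<mu>")
  case True
  then have "2 / (a + c) * a \<le> \<mu> * a" using assms by (intro mult_right_mono) auto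
  moreover have "2 / (a + c) * a - 1 = (a - c) / (a + c)" using assms by (simp add: field_simps)
  ultimately show ?thesis by linarith
next
  case False
  then have "\<mu> * c \<le> 2 / (a + c) * c" using assms by (intro mult_right_mono) auto
  moreover have "1 - 2 / (a + c) * c = (a - c) / (a + c)" using assms by (simp add: field_simps)
  ultimately show ?thesis by linarith
qed

lemma eigenvalue_of_singular_value:
  assumes A: "A \<in> carrier_mat m n" and s: "s \<in># singular_values A" and "0 < s"
  shows "eigenvalue (transpose_mat A * A) (s\<^sup>2)"
proof -
  have C: "transpose_mat A * A \<in> carrier_mat n n" using A by simp
  from s obtain x where x: "x \<in># proots (char_poly (transpose_mat A * A))" "s = sqrt x"
    unfolding singular_values_def by auto
  have "x = s\<^sup>2" using x(2) \<open>0 < s\<close> by simp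
  moreover have "char_poly (transpose_mat A * A) \<noteq> 0"
    using degree_monic_char_poly[OF C] by auto
  ultimately show ?thesis
    using x(1) eigenvalue_root_char_poly[OF C] by simp
qed

lemma lspia_mat_spectral_radius_ge:
  assumes A: "A \<in> carrier_mat m n" and n: "0 < n"
    and s: "s \<in># singular_values A" "0 < s" and s': "s' \<in># singular_values A" "0 < s'"
  shows "(s\<^sup>2 - s'\<^sup>2) / (s\<^sup>2 + s'\<^sup>2) \<le> real_spectral_radius (lspia_mat A \<mu>)"
proof -
  have C: "transpose_mat A * A \<in> carrier_mat n n" using A by simp
  have L: "lspia_mat A \<mu> = 1\<^sub>m n - \<mu> \<cdot>\<^sub>m (transpose_mat A * A)"
    using A by (auto simp: lspia_mat_def)
  then have L': "lspia_mat A \<mu> \<in> carrier_mat n n"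
    using C by (auto intro: minus_carrier_mat)
  have le: "\<bar>1 - \<mu> * x\<^sup>2\<bar> \<le> real_spectral_radius (lspia_mat A \<mu>)"
    if "x \<in># singular_values A" "0 < x" for x
    using abs_le_real_spectral_radius[OF L' n]
      eigenvalue_one_minus_smult[OF C eigenvalue_of_singular_value[OF A that], of \<mu>] L by simp
  have "(s\<^sup>2 - s'\<^sup>2) / (s\<^sup>2 + s'\<^sup>2) \<le> max \<bar>1 - \<mu> * s\<^sup>2\<bar> \<bar>1 - \<mu> * s'\<^sup>2\<bar>"
    using s(2) s'(2) by (intro two_point_step_size_bound) (auto simp: add_pos_pos)
  then show ?thesis using le[OF s] le[OF s'] by linarith
qed

section \<open>The comparison\<close>

lemma rank_pos_of_nonzero_entry:
  fixes A :: "'a :: field mat"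
  assumes A: "A \<in> carrier_mat m n" and ij: "i < m" "j < n" and "A $$ (i, j) \<noteq> 0"
  shows "1 \<le> vec_space.rank m A"
proof -
  interpret vec_space "TYPE('a)" m .
  have [simp]: "{k. k < m \<and> k = i} = {i}" "{k. k < n \<and> k = j} = {j}" using ij by auto
  let ?S = "submatrix A {i} {j}"
  have "?S \<in> carrier_mat 1 1"
    using A by (intro carrier_matI) (auto simp: dim_submatrix)
  then have "det ?S = ?S $$ (0, 0)" by (simp add: det_single)
  also have "\<dots> = A $$ (i, j)"
    using submatrix_index_card[of i A j "{i}" "{j}"] A ij by (simp add: conj_commute cong: conj_cong)
  finally have "det ?S \<noteq> 0" using assms(4) by simp
  from rank_gt_minor[OF A this] show ?thesis by simp
qed

lemma collocation_mat_rank_pos: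
  assumes basis: "ntp_basis b n" and i: "i \<in> {1..m}" and ti: "t i \<in> {0..1}"
  shows "1 \<le> vec_space.rank m (collocation_mat b n t m)"
proof -
  have "(\<Sum>j=1..n. b j (t i)) = 1"
    using basis ti unfolding ntp_basis_def by blast
  then obtain j where j: "j \<in> {1..n}" "b j (t i) \<noteq> 0"
    by (metis sum.neutral zero_neq_one)
  show ?thesis
    by (rule rank_pos_of_nonzero_entry[of _ m n "i - 1" "j - 1"])
       (use i j in \<open>auto simp: collocation_mat_def\<close>)
qed

text \<open>Both quotients have the numerator \<open>a\<^sup>2 - c\<^sup>2\<close> once the left one is expanded by \<open>a + c\<close>.\<close>

lemma spread_quotient_less:
  fixes a c :: real
  assumes "0 < c" and "c < a"
  shows "(a - c) / (a + c) < (a\<^sup>2 - c\<^sup>2) / (a\<^sup>2 + c\<^sup>2)"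
proof -
  have q: "a\<^sup>2 + c\<^sup>2 < (a + c)\<^sup>2" "0 < a\<^sup>2 + c\<^sup>2"
    using assms by (simp_all add: power2_sum add_pos_pos)
  have "(a - c) / (a + c) = (a\<^sup>2 - c\<^sup>2) / (a + c)\<^sup>2"
    using assms by (simp add: power2_eq_square square_diff_square_factored)
  also have "\<dots> < (a\<^sup>2 - c\<^sup>2) / (a\<^sup>2 + c\<^sup>2)"
    using assms q by (intro divide_strict_left_mono) (auto simp: power_strict_mono)
  finally show ?thesis .
qed

theorem theorem6:
  fixes b :: "nat \<Rightarrow> real \<Rightarrow> real"
    and t \<sigma> :: "nat \<Rightarrow> real"
    and B :: "real mat"
    and m n r :: nat
  assumes "ntp_basis b n"
    and "n < m"
    and "t 1 = 0" and "t m = 1" and "strict_mono_on {1..m} t"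
    and "B = collocation_mat b n t m"
    and "vec_space.rank m B = r"
    and "image_mset \<sigma> (mset_set {1..r}) = filter_mset (\<lambda>s. s \<noteq> 0) (singular_values B)"
    and "antimono_on {1..r} \<sigma>"
    and "\<forall>i\<in>{1..r}. 0 < \<sigma> i"
  shows
    "(let \<omega> = 4 * \<sigma> 1 * \<sigma> r / (\<sigma> 1 + \<sigma> r)\<^sup>2;
          \<gamma> = 4 * \<sigma> 1 * \<sigma> r / (\<sigma> 1 + \<sigma> r)\<^sup>2;
          \<upsilon> = 1 / (\<sigma> 1 * \<sigma> r)
      in real_spectral_radius (mlspia_mat m r \<sigma> \<omega> \<gamma> \<upsilon>) = (\<sigma> 1 - \<sigma> r) / (\<sigma> 1 + \<sigma> r)
         \<and> (\<sigma> 1 - \<sigma> r) / (\<sigma> 1 + \<sigma> r) \<le> ((\<sigma> 1)\<^sup>2 - (\<sigma> r)\<^sup>2) / ((\<sigma> 1)\<^sup>2 + (\<sigma> r)\<^sup>2)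
         \<and> ((\<sigma> 1)\<^sup>2 - (\<sigma> r)\<^sup>2) / ((\<sigma> 1)\<^sup>2 + (\<sigma> r)\<^sup>2) < 1)
     \<and> (r = n \<and> \<sigma> 1 \<noteq> \<sigma> r \<longrightarrow>
         (INF (\<omega>, \<gamma>, \<upsilon>)\<in>{(\<omega>, \<gamma>, \<upsilon>). real_spectral_radius (mlspia_mat m r \<sigma> \<omega> \<gamma> \<upsilon>) < 1}.
            real_spectral_radius (mlspia_mat m r \<sigma> \<omega> \<gamma> \<upsilon>))
         < (INF \<mu>\<in>{0<..}. real_spectral_radius (lspia_mat B \<mu>)))"
proof -
  have B: "B \<in> carrier_mat m n"
    using assms(6) by (simp add: collocation_mat_def)
  have r1: "1 \<le> r"
    using collocation_mat_rank_pos[OF assms(1), of 1 m t] assms(2,3,6,7) by simp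
  have rn: "r \<le> n"
    using vec_space.rank_le_nc[OF B] assms(7) by simp
  have rm: "r < m" and n: "0 < n" using r1 rn assms(2) by auto
  have range: "\<sigma> r \<le> \<sigma> i \<and> \<sigma> i \<le> \<sigma> 1" if "i \<in> {1..r}" for i
    using that assms(9) by (auto simp: monotone_on_def)
  have pos: "0 < \<sigma> r" "0 < \<sigma> 1" "\<sigma> r \<le> \<sigma> 1"
    using assms(10) r1 range[of 1] by auto
  define \<omega> where "\<omega> = 4 * \<sigma> 1 * \<sigma> r / (\<sigma> 1 + \<sigma> r)\<^sup>2"
  define \<rho> where "\<rho> = (\<sigma> 1 - \<sigma> r) / (\<sigma> 1 + \<sigma> r)"
  define \<tau> where "\<tau> = ((\<sigma> 1)\<^sup>2 - (\<sigma> r)\<^sup>2) / ((\<sigma> 1)\<^sup>2 + (\<sigma> r)\<^sup>2)"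
  let ?R = "\<lambda>(\<omega>, \<gamma>, \<upsilon>). real_spectral_radius (mlspia_mat m r \<sigma> \<omega> \<gamma> \<upsilon>)"
  let ?W = "{(\<omega>, \<gamma>, \<upsilon>). real_spectral_radius (mlspia_mat m r \<sigma> \<omega> \<gamma> \<upsilon>) < 1}"
  have opt: "real_spectral_radius (mlspia_mat m r \<sigma> \<omega> \<omega> (1 / (\<sigma> 1 * \<sigma> r))) = \<rho>"
    unfolding \<omega>_def \<rho>_def
    by (rule real_spectral_radius_mlspia_mat_balanced[OF r1 rm pos(1) range])
  have less: "\<rho> < \<tau>" if "\<sigma> 1 \<noteq> \<sigma> r"
    unfolding \<rho>_def \<tau>_def using spread_quotient_less pos that by simp
  have le: "\<rho> \<le> \<tau>"
    using less by (cases "\<sigma> 1 = \<sigma> r") (auto simp: \<rho>_def \<tau>_def)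
  have \<tau>1: "\<tau> < 1"
    using pos by (simp add: \<tau>_def divide_less_eq add_pos_pos)
  have "(INF w\<in>?W. ?R w) < (INF \<mu>\<in>{0<..}. real_spectral_radius (lspia_mat B \<mu>))"
    if "\<sigma> 1 \<noteq> \<sigma> r"
  proof -
    have "(INF w\<in>?W. ?R w) \<le> ?R (\<omega>, \<omega>, 1 / (\<sigma> 1 * \<sigma> r))"
    proof (rule cINF_lower)
      show "bdd_below (?R ` ?W)"
        using rm by (intro bdd_belowI[of _ 0])
          (auto intro!: real_spectral_radius_nonneg mlspia_mat_carrier)
      show "(\<omega>, \<omega>, 1 / (\<sigma> 1 * \<sigma> r)) \<in> ?W" using opt le \<tau>1 by simp
    qed
    also have "\<dots> = \<rho>" using opt by simp
    also have "\<dots> < \<tau>" using less[OF that] .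
    also have "\<tau> \<le> (INF \<mu>\<in>{0<..}. real_spectral_radius (lspia_mat B \<mu>))"
    proof (rule cINF_greatest)
      have sv: "\<sigma> i \<in># singular_values B" if "i \<in> {1..r}" for i
      proof -
        have "\<sigma> i \<in># image_mset \<sigma> (mset_set {1..r})" using that by simp
        then show ?thesis unfolding assms(8) by simp
      qed
      show "\<tau> \<le> real_spectral_radius (lspia_mat B \<mu>)" for \<mu>
        unfolding \<tau>_def using sv[of 1] sv[of r] r1 pos
        by (intro lspia_mat_spectral_radius_ge[OF B n]) auto
    qed simp
    finally show ?thesis .
  qed
  then show ?thesis
    using opt le \<tau>1 unfolding Let_def \<omega>_def[symmetric] \<rho>_def[symmetric] \<tau>_def[symmetric]
    by blast
qed

end
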